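(* Let $m \le n$ be positive integers, let $\kappa = m+n-3$, and let $\mathcal{X} \subset \mathbb{C}^2$ be a set of (distinct) points with $\#\mathcal{X} \le mn-1$. Then $\mathcal{X}$ is $\kappa$-dependent if and only if there exist an integer $r$ with $1 \le r \le m-1$ and an essentially $\kappa$-dependent subset $\mathcal{Y} \subseteq \mathcal{X}$ such that $\#\mathcal{Y} \ge rs$, where $s$ is defined by $r+s-3=\kappa$, and such that $\mathcal{Y}$ is contained in a plane algebraic curve of degree $r$ and is not contained in any plane algebraic curve of degree less than $r$. Moreover, for any such $r$, $s$ and $\mathcal{Y}$, if $\#\mathcal{Y} = rs$, then $\mathcal{Y}$ coincides with the set of intersection points of some two plane algebraic curves of degrees $r$ and $s$, respectively.
   Context: For an integer $k$, $\Pi_k$ denotes the space of bivariate polynomials (with complex coefficients) of total degree at most $k$; for $k<0$ this is $\{0\}$. A plane algebraic curve of degree $d$ is the zero set in $\mathbb{C}^2$ of a bivariate polynomial of total degree $d$ without multiple factors. Let $\mathcal{X} \subset \mathbb{C}^2$ be a finite set of points and $A \in \mathcal{X}$. A polynomial $p \in \Pi_k$ is a $k$-fundamental polynomial of $A$ (with respect to $\mathcal{X}$) if $p(A)=1$ and $p$ vanishes at every point of $\mathcal{X}\setminus\{A\}$. The set $\mathcal{X}$ is $k$-independent if each of its points has a $k$-fundamental polynomial with respect to $\mathcal{X}$; otherwise it is $k$-dependent. The set $\mathcal{X}$ is essentially $k$-dependent if none of its points has a $k$-fundamental polynomial with respect to $\mathcal{X}$. *)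

theory Defs
  imports Complex_Main
    "HOL-Computational_Algebra.Computational_Algebra"
begin

text \<open>A polynomial in \<open>x, y\<close> over the complex numbers is an element of \<open>\<complex>[x][y]\<close>:
  the coefficient of \<open>x\<^sup>j y\<^sup>i\<close> in \<open>p\<close> is \<open>coeff (coeff p i) j\<close>.\<close>

type_synonym bipoly = "complex poly poly"

definition eval2 :: "bipoly \<Rightarrow> complex \<times> complex \<Rightarrow> complex" where
  "eval2 p A = poly (poly p [:snd A:]) (fst A)"

text \<open>The zero polynomial gets total degree \<open>0\<close>.\<close>

definition total_degree :: "bipoly \<Rightarrow> nat" where
  "total_degree p = Max (insert 0 {i + j | i j. coeff (coeff p i) j \<noteq> 0})"

lemma finite_exponents: "finite {i + j | i j. coeff (coeff p i) j \<noteq> 0}"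
  for p :: bipoly
proof (rule finite_subset)
  show "{i + j | i j. coeff (coeff p i) j \<noteq> 0}
      \<subseteq> (\<lambda>(i, j). i + j) ` (SIGMA i:{..degree p}. {..degree (coeff p i)})"
    by (force intro: le_degree)
qed auto

lemma total_degree_le_iff:
  "total_degree p \<le> k \<longleftrightarrow> (\<forall>i j. coeff (coeff p i) j \<noteq> 0 \<longrightarrow> i + j \<le> k)"
  unfolding total_degree_def by (subst Max_le_iff) (auto simp: finite_exponents)

definition Pi_deg :: "int \<Rightarrow> bipoly set" where
  "Pi_deg k = {p. p = 0 \<or> int (total_degree p) \<le> k}"

text \<open>Note that \<^const>\<open>squarefree\<close> excludes the zero polynomial.\<close>

definition plane_curve :: "nat \<Rightarrow> (complex \<times> complex) set \<Rightarrow> bool" where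
  "plane_curve d C \<longleftrightarrow>
     (\<exists>p. squarefree p \<and> total_degree p = d \<and> C = {A. eval2 p A = 0})"

definition fundamental_poly ::
  "int \<Rightarrow> (complex \<times> complex) set \<Rightarrow> complex \<times> complex \<Rightarrow> bipoly \<Rightarrow> bool" where
  "fundamental_poly k X A p \<longleftrightarrow>
     p \<in> Pi_deg k \<and> eval2 p A = 1 \<and> (\<forall>B\<in>X - {A}. eval2 p B = 0)"

definition independent_pts :: "int \<Rightarrow> (complex \<times> complex) set \<Rightarrow> bool" where
  "independent_pts k X \<longleftrightarrow> (\<forall>A\<in>X. \<exists>p. fundamental_poly k X A p)"

abbreviation dependent_pts :: "int \<Rightarrow> (complex \<times> complex) set \<Rightarrow> bool" where
  "dependent_pts k X \<equiv> \<not> independent_pts k X"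

definition essentially_dependent :: "int \<Rightarrow> (complex \<times> complex) set \<Rightarrow> bool" where
  "essentially_dependent k X \<longleftrightarrow> (\<forall>A\<in>X. \<not> (\<exists>p. fundamental_poly k X A p))"

text \<open>The conditions on \<open>r\<close>, \<open>s\<close> and \<open>Y\<close> shared by the criterion and its addendum. For
  \<open>r \<le> m - 1\<close> and \<open>k = m + n - 3\<close> the equation forces \<open>s = m + n - r > n\<close>, so taking \<open>s\<close> to
  be a natural number loses nothing.\<close>

definition dependence_witness ::
  "int \<Rightarrow> nat \<Rightarrow> (complex \<times> complex) set \<Rightarrow> nat \<Rightarrow> nat \<Rightarrow> (complex \<times> complex) set \<Rightarrow> bool" where
  "dependence_witness k m X r s Y \<longleftrightarrow>
     1 \<le> r \<and> r \<le> m - 1 \<and> int r + int s - 3 = k \<and>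
     Y \<subseteq> X \<and> essentially_dependent k Y \<and> card Y \<ge> r * s \<and>
     (\<exists>C. plane_curve r C \<and> Y \<subseteq> C) \<and>
     \<not> (\<exists>d C. d < r \<and> plane_curve d C \<and> Y \<subseteq> C)"

end

theory Submission
  imports Defs "HOL-Computational_Algebra.Field_as_Ring"
begin

text \<open>
  Essential dependence is a Cayley--Bacharach condition, and two products with it carry the whole
  proof. Let \<open>Y\<close> be essentially \<open>k\<close>-dependent, so that a polynomial of degree at most \<open>k\<close> that
  vanishes at all points of \<open>Y\<close> but one vanishes at that one too.
  \<^item> Multiplying by a polynomial \<open>G\<close> of degree \<open>e\<close> shows that the part of \<open>Y\<close> off the curve
    \<open>G = 0\<close> is essentially \<open>(k - e)\<close>-dependent (\<open>essentially_dependent_off_curve\<close>).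
  \<^item> Multiplying by the \<open>i\<close>-fundamental polynomials of an \<open>i\<close>-independent \<open>B \<subseteq> Y\<close> shows that a
    polynomial of degree at most \<open>k - i\<close> that vanishes on \<open>Y - B\<close> vanishes on all of \<open>Y\<close>
    (\<open>vanish_off_independent_imp_vanish\<close>): imposing that it vanishes on \<open>Y\<close> costs only
    \<open>card Y - card B\<close> conditions.

  Let \<open>p\<close> be a nonzero polynomial of least degree \<open>r\<close> vanishing on \<open>Y\<close> and put \<open>r + s = k + 3\<close>.
  Suppose that \<open>q\<close> also vanishes on \<open>Y\<close>, and let \<open>G\<close>, of degree \<open>e\<close>, be the greatest common divisor
  of \<open>p\<close> and \<open>q\<close>. The points of \<open>Y\<close> off \<open>G = 0\<close> are common zeros of the coprime polynomials
  \<open>p / G\<close> and \<open>q / G\<close>, and common zeros of coprime polynomials of degrees \<open>a\<close> and \<open>b\<close> are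
  \<open>(a + b - 2)\<close>-independent (\<open>complete_intersection_independent\<close>). If \<open>G\<close> is a proper divisor of \<open>p\<close>
  there are such points, by minimality of \<open>r\<close>, so this clashes with the first product unless the
  degree of \<open>q\<close> is at least \<open>s + e\<close>. Hence every \<open>q\<close> of degree less than \<open>s\<close> is a multiple of \<open>p\<close>, and
  every \<open>q\<close> of degree \<open>s\<close> is a multiple of \<open>p\<close> or coprime to it (\<open>least_degree_poly_factor\<close>).

  What remains is counting. If \<open>Y\<close> had fewer than \<open>rs\<close> points, the second product with a
  \<open>(r - 1)\<close>-independent \<open>B\<close> would leave so few conditions that a polynomial of degree at most
  \<open>s - 2\<close> vanishing on \<open>Y\<close> exists that is not a multiple of \<open>p\<close>, so \<open>card Y \<ge> rs\<close>
  (\<open>card_essentially_dependent_ge\<close>). Similarly \<open>r \<ge> m\<close> forces \<open>card Y \<ge> mn\<close>. Applied to the set of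
  all points of \<open>X\<close> without a fundamental polynomial, which is essentially dependent, this gives the
  criterion. If \<open>card Y = rs\<close>, the same count one step further, with a \<open>(r - 3)\<close>-independent \<open>B\<close>,
  yields a polynomial \<open>g\<close> of degree \<open>s\<close> vanishing on \<open>Y\<close> and coprime to \<open>p\<close>; by Bezout's
  inequality the curves of \<open>p\<close> and \<open>g\<close> meet in at most \<open>rs\<close> points, so exactly in \<open>Y\<close>, and a multiple
  factor of \<open>g\<close> would leave room for fewer than \<open>rs\<close> of them.
\<close>

section \<open>Linear systems and univariate polynomials\<close>

lemma coprime_if_no_common_root:
  fixes P Q :: "complex poly"
  assumes "P \<noteq> 0" "\<And>z. poly P z = 0 \<Longrightarrow> poly Q z \<noteq> 0"
  shows "coprime P Q"
proof (rule coprimeI)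
  fix D assume D: "D dvd P" "D dvd Q"
  show "is_unit D"
  proof (rule ccontr)
    assume "\<not> is_unit D"
    with assms(1) D have "degree D \<noteq> 0" by (metis dvd_0_left_iff is_unit_iff_degree)
    then obtain z where "poly D z = 0" 
      using fundamental_theorem_of_algebra constant_degree by metis
    with D assms(2) show False by (meson poly_eq_0_iff_dvd dvd_trans)
  qed
qed

lemma coeff_mult_top:
  assumes "degree a \<le> m" "degree b \<le> n"
  shows "coeff (a * b) (m + n) = coeff a m * coeff b n"
proof -
  have "coeff (a * b) (m + n) = (\<Sum>i\<le>m+n. coeff a i * coeff b (m + n - i))" by (simp add: coeff_mult)
  also have "\<dots> = (\<Sum>i\<in>{m}. coeff a i * coeff b (m + n - i))"
  proof (rule sum.mono_neutral_right)
    show "\<forall>i\<in>{..m + n} - {m}. coeff a i * coeff b (m + n - i) = 0"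
    proof
      fix i assume "i \<in> {..m + n} - {m}"
      then have "m < i \<or> n < m + n - i" by auto
      then show "coeff a i * coeff b (m + n - i) = 0" using assms
        by (metis coeff_eq_0 le_less_trans mult_zero_left mult_zero_right)
    qed
  qed auto
  finally show ?thesis by simp
qed

text \<open>A homogeneous linear system with more unknowns than equations has a nontrivial solution, by
  elimination of one unknown per equation. The equations are indexed by \<open>J\<close>, the unknowns by \<open>I\<close>.\<close>

lemma homogeneous_system:
  fixes M :: "'j \<Rightarrow> 'i \<Rightarrow> 'a::field"
  assumes "finite J" "finite I" "card J < card I"
  shows "\<exists>c. (\<exists>i\<in>I. c i \<noteq> 0) \<and> (\<forall>j\<in>J. (\<Sum>i\<in>I. c i * M j i) = 0)"
  using assms
proof (induction J arbitrary: I M rule: finite_induct)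
  case empty
  then obtain i where "i \<in> I" by fastforce
  then show ?case by (intro exI[of _ "\<lambda>_. 1"]) auto
next
  case (insert j J)
  show ?case
  proof (cases "\<forall>i\<in>I. M j i = 0")
    case True
    have "card J < card I" using insert by simp
    from insert.IH[OF insert.prems(1) this, of M]
    obtain c where c: "\<exists>i\<in>I. c i \<noteq> 0" "\<forall>j\<in>J. (\<Sum>i\<in>I. c i * M j i) = 0"
      by blast
    then show ?thesis using True by (intro exI[of _ c]) auto
  next
    case False
    then obtain p where p: "p \<in> I" "M j p \<noteq> 0" by auto
    \<comment> \<open>Equation \<open>j\<close> eliminates the unknown \<open>p\<close> from the other equations.\<close>
    define M' where "M' k i = M k i - M k p * M j i / M j p" for k i
    have "card J < card (I - {p})" using insert p by simp
    from insert.IH[OF _ this, of M'] insert.prems obtain c where c: "\<exists>i\<in>I-{p}. c i \<noteq> 0"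
        "\<forall>k\<in>J. (\<Sum>i\<in>I-{p}. c i * M' k i) = 0"
      by blast
    define c' where "c' = c(p := - (\<Sum>i\<in>I-{p}. c i * M j i) / M j p)"
    have eq: "(\<Sum>i\<in>I. c' i * M k i) = (\<Sum>i\<in>I-{p}. c i * M' k i)" for k
    proof -
      have "(\<Sum>i\<in>I. c' i * M k i) = c' p * M k p + (\<Sum>i\<in>I-{p}. c' i * M k i)"
        using p insert by (simp add: sum.remove)
      also have "(\<Sum>i\<in>I-{p}. c' i * M k i) = (\<Sum>i\<in>I-{p}. c i * M k i)"
        by (rule sum.cong) (auto simp: c'_def)
      also have "c' p * M k p = - (\<Sum>i\<in>I-{p}. c i * (M k p * M j i / M j p))"
        by (simp add: c'_def sum_distrib_left sum_distrib_right sum_divide_distrib mult_ac)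
      finally show ?thesis by (simp add: M'_def right_diff_distrib sum_subtractf)
    qed
    have "(\<Sum>i\<in>I. c' i * M j i) = 0"
      unfolding eq using p by (simp add: M'_def)
    moreover have "\<exists>i\<in>I. c' i \<noteq> 0" using c(1) by (auto simp: c'_def)
    ultimately show ?thesis using c(2) eq by (intro exI[of _ c']) auto
  qed
qed

section \<open>Total degree and restriction to lines\<close>

lemma eval2_simps [simp]:
  "eval2 0 A = 0" "eval2 1 A = 1" "eval2 (- p) A = - eval2 p A"
  "eval2 (p + q) A = eval2 p A + eval2 q A" "eval2 (p - q) A = eval2 p A - eval2 q A"
  "eval2 (p * q) A = eval2 p A * eval2 q A" "eval2 (smult [:c:] p) A = c * eval2 p A"
  by (simp_all add: eval2_def)

lemma eval2_sum [simp]: "eval2 (\<Sum>i\<in>I. f i) A = (\<Sum>i\<in>I. eval2 (f i) A)"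
  by (induction I rule: infinite_finite_induct) auto

lemma eval2_prod [simp]: "eval2 (\<Prod>i\<in>I. f i) A = (\<Prod>i\<in>I. eval2 (f i) A)"
  by (induction I rule: infinite_finite_induct) auto

lemma coeff_coeff_eq_0: "total_degree p < i + j \<Longrightarrow> coeff (coeff p i) j = 0"
  using total_degree_le_iff[of p "total_degree p"] by (metis le_refl not_less)

lemma degree_coeff_le: "degree (coeff p i) \<le> total_degree p - i"
  by (rule degree_le) (auto intro: coeff_coeff_eq_0)

lemma degree_le_total_degree: "degree p \<le> total_degree p"
  by (rule degree_le) (auto simp: poly_eq_iff intro: coeff_coeff_eq_0)

lemma total_degree_attained:
  assumes "p \<noteq> 0"
  obtains i where "i \<le> total_degree p" "coeff (coeff p i) (total_degree p - i) \<noteq> 0"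
proof -
  let ?E = "{i + j | i j. coeff (coeff p i) j \<noteq> 0}"
  have "\<exists>i j. coeff (coeff p i) j \<noteq> 0" using assms by (metis leading_coeff_0_iff)
  then have ne: "?E \<noteq> {}" by auto
  then have "total_degree p = Max ?E"
    unfolding total_degree_def by (subst Max_insert) (auto simp: finite_exponents)
  then have "total_degree p \<in> ?E" using Max_in[OF finite_exponents ne] by simp
  then obtain i j where "total_degree p = i + j" "coeff (coeff p i) j \<noteq> 0" by auto
  then show ?thesis using that[of i] by simp
qed

lemma coeff_linear_power: "coeff ([:c, t:] ^ i) i = (t :: complex) ^ i"
proof (induction i)
  case (Suc i)
  have "degree ([:c, t:] ^ i) \<le> i" using degree_power_le[of "[:c,t:]" i] by (simp split: if_splits)
  then have "coeff ([:c, t:] * [:c, t:] ^ i) (1 + i) = coeff [:c, t:] 1 * coeff ([:c, t:] ^ i) i"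
    by (intro coeff_mult_top) auto
  then show ?case using Suc by simp
qed auto

lemma poly_eq_sum_total_degree: "poly p z = (\<Sum>i\<le>total_degree p. coeff p i * z ^ i)"
  unfolding poly_altdef
  by (rule sum.mono_neutral_left) (auto simp: coeff_eq_0 degree_le_total_degree not_le)

text \<open>The polynomial \<open>poly p [:c, t:]\<close> is the restriction of \<open>p\<close> to the line \<open>y = c + t x\<close>, as a
  polynomial in \<open>x\<close>: the outer variable \<open>y\<close> is replaced by \<open>c + t x\<close>.\<close>

lemma degree_restrict_le: "degree (poly p [:c, t:]) \<le> total_degree p"
  unfolding poly_eq_sum_total_degree
proof (rule degree_sum_le)
  fix i assume i: "i \<in> {..total_degree p}"
  have "degree ([:c, t:] ^ i) \<le> i" using degree_power_le[of "[:c,t:]" i] by (simp split: if_splits)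
  then show "degree (coeff p i * [:c, t:] ^ i) \<le> total_degree p"
    using degree_mult_le[of "coeff p i" "[:c,t:]^i"] degree_coeff_le[of p i] i by simp
qed auto

text \<open>The coefficient in question is the value of the leading form of \<open>p\<close> at \<open>(1, t)\<close>, whence its
  independence of \<open>c\<close>.\<close>

lemma coeff_restrict_top:
  "coeff (poly p [:c, t:]) (total_degree p) =
   (\<Sum>i\<le>total_degree p. coeff (coeff p i) (total_degree p - i) * t ^ i)"
  unfolding poly_eq_sum_total_degree[of p "[:c,t:]"] coeff_sum
proof (rule sum.cong)
  fix i assume i: "i \<in> {..total_degree p}"
  have "degree ([:c, t:] ^ i) \<le> i" using degree_power_le[of "[:c,t:]" i] by (simp split: if_splits)
  then have "coeff (coeff p i * [:c, t:] ^ i) (total_degree p - i + i) =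
      coeff (coeff p i) (total_degree p - i) * coeff ([:c, t:] ^ i) i"
    by (intro coeff_mult_top degree_coeff_le) auto
  then show "coeff (coeff p i * [:c, t:] ^ i) (total_degree p) =
      coeff (coeff p i) (total_degree p - i) * t ^ i"
    using i by (simp add: coeff_linear_power)
qed auto

text \<open>The excluded slopes are those of the asymptotic directions of the curve. Along lines of any other slope
  the restriction keeps the full degree, and this transfers the degree formula for products from one
  variable to two.\<close>

lemma finite_asymptotic_slopes:
  assumes "p \<noteq> 0"
  shows "finite {t. \<exists>c. coeff (poly p [:c, t:]) (total_degree p) = 0}"
proof -
  define T where "T = (\<Sum>i\<le>total_degree p. monom (coeff (coeff p i) (total_degree p - i)) i)"
  have T: "poly T t = coeff (poly p [:c, t:]) (total_degree p)" for c t
    unfolding coeff_restrict_top by (simp add: T_def poly_sum poly_monom)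
  obtain i where i: "i \<le> total_degree p" "coeff (coeff p i) (total_degree p - i) \<noteq> 0"
    using total_degree_attained[OF assms] .
  have "coeff T i = coeff (coeff p i) (total_degree p - i)"
    unfolding T_def coeff_sum using i(1) by (simp add: sum.delta)
  with i have "T \<noteq> 0" by auto
  then show ?thesis using poly_roots_finite[of T] by (simp flip: T)
qed

lemma total_degree_mult:
  assumes "p \<noteq> 0" "q \<noteq> 0"
  shows "total_degree (p * q) = total_degree p + total_degree q"
proof -
  let ?S = "\<lambda>p. {t. \<exists>c. coeff (poly p [:c, t:]) (total_degree p) = 0}"
  have fin: "finite (?S p \<union> ?S q \<union> ?S (p * q))"
    using assms by (intro finite_UnI finite_asymptotic_slopes) auto
  obtain t where t: "t \<notin> ?S p \<union> ?S q \<union> ?S (p * q)"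
    by (rule exE[OF ex_new_if_finite[OF infinite_UNIV_char_0 fin]])
  have deg: "poly r [:0, t:] \<noteq> 0 \<and> degree (poly r [:0, t:]) = total_degree r" if "t \<notin> ?S r" for r
  proof -
    have "coeff (poly r [:0, t:]) (total_degree r) \<noteq> 0" using that by blast
    then show ?thesis using degree_restrict_le[of r 0 t] by (auto intro: le_degree antisym)
  qed
  have tp: "t \<notin> ?S p" "t \<notin> ?S q" "t \<notin> ?S (p * q)"
    using t by (simp_all only: Un_iff de_Morgan_disj not_False_eq_True)
  have "total_degree (p * q) = degree (poly p [:0, t:] * poly q [:0, t:])"
    using deg[OF tp(3)] unfolding poly_mult by simp
  also have "\<dots> = total_degree p + total_degree q"
    using deg[OF tp(1)] deg[OF tp(2)] by (simp add: degree_mult_eq)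
  finally show ?thesis .
qed

text \<open>This form of membership needs no case distinction on negative \<open>k\<close> and is linear in \<open>p\<close>.\<close>

lemma mem_Pi_deg_iff: "p \<in> Pi_deg k \<longleftrightarrow> (\<forall>i j. coeff (coeff p i) j \<noteq> 0 \<longrightarrow> int (i + j) \<le> k)"
proof (cases "p = 0")
  case False
  then obtain i where i: "i \<le> total_degree p" "coeff (coeff p i) (total_degree p - i) \<noteq> 0"
    using total_degree_attained by blast
  show ?thesis
  proof
    assume "p \<in> Pi_deg k"
    with False have "int (total_degree p) \<le> k" by (simp add: Pi_deg_def)
    moreover have "i + j \<le> total_degree p" if "coeff (coeff p i) j \<noteq> 0" for i j
      using that coeff_coeff_eq_0[of p i j] by linarith
    ultimately show "\<forall>i j. coeff (coeff p i) j \<noteq> 0 \<longrightarrow> int (i + j) \<le> k"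
      by fastforce
  next
    assume "\<forall>i j. coeff (coeff p i) j \<noteq> 0 \<longrightarrow> int (i + j) \<le> k"
    with i have "int (i + (total_degree p - i)) \<le> k" by blast
    with i show "p \<in> Pi_deg k" by (simp add: Pi_deg_def)
  qed
qed (simp add: Pi_deg_def)

lemma Pi_deg_mono: "p \<in> Pi_deg k \<Longrightarrow> k \<le> l \<Longrightarrow> p \<in> Pi_deg l"
  by (auto simp: Pi_deg_def)

lemma zero_in_Pi_deg [simp]: "0 \<in> Pi_deg k"
  by (simp add: Pi_deg_def)

lemma one_in_Pi_deg: "0 \<le> k \<Longrightarrow> 1 \<in> Pi_deg k"
  by (auto simp: mem_Pi_deg_iff coeff_pCons one_pCons split: nat.splits)

lemma Pi_deg_add: "p \<in> Pi_deg k \<Longrightarrow> q \<in> Pi_deg k \<Longrightarrow> p + q \<in> Pi_deg k"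
  unfolding mem_Pi_deg_iff by (metis add.left_neutral coeff_add)

lemma Pi_deg_smult: "p \<in> Pi_deg k \<Longrightarrow> smult [:c:] p \<in> Pi_deg k"
  by (auto simp: mem_Pi_deg_iff)

lemma Pi_deg_uminus: "p \<in> Pi_deg k \<Longrightarrow> - p \<in> Pi_deg k"
  by (auto simp: mem_Pi_deg_iff)

lemma Pi_deg_diff: "p \<in> Pi_deg k \<Longrightarrow> q \<in> Pi_deg k \<Longrightarrow> p - q \<in> Pi_deg k"
  using Pi_deg_add[of p k "- q"] Pi_deg_uminus[of q k] by simp

lemma Pi_deg_sum: "(\<And>i. i \<in> I \<Longrightarrow> f i \<in> Pi_deg k) \<Longrightarrow> (\<Sum>i\<in>I. f i) \<in> Pi_deg k"
  by (induction I rule: infinite_finite_induct) (auto intro: Pi_deg_add)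

lemma Pi_deg_mult: "p \<in> Pi_deg k \<Longrightarrow> q \<in> Pi_deg l \<Longrightarrow> p * q \<in> Pi_deg (k + l)"
  by (cases "p = 0 \<or> q = 0") (auto simp: Pi_deg_def total_degree_mult)

lemma Pi_deg_mult_cancel: "p * q \<in> Pi_deg k \<Longrightarrow> p \<noteq> 0 \<Longrightarrow> q \<in> Pi_deg (k - int (total_degree p))"
  by (cases "q = 0") (auto simp: Pi_deg_def total_degree_mult)

lemma in_Pi_deg_total_degree: "p \<in> Pi_deg (int (total_degree p))"
  by (simp add: Pi_deg_def)

lemma total_degree_0_imp_const:
  assumes "total_degree p = 0"
  shows "p = [:[:coeff (coeff p 0) 0:]:]"
  using coeff_coeff_eq_0[of p] assms
  by (intro poly_eqI) (auto simp: coeff_pCons split: nat.splits)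

lemma is_unit_iff_total_degree: "p dvd 1 \<longleftrightarrow> p \<noteq> 0 \<and> total_degree p = 0"
proof
  assume "p dvd 1"
  then obtain q where q: "1 = p * q" by (elim dvdE)
  then have "p \<noteq> 0" "q \<noteq> 0" by auto
  moreover have "total_degree 1 = 0" 
    using one_in_Pi_deg[of 0] by (simp add: Pi_deg_def)
  ultimately show "p \<noteq> 0 \<and> total_degree p = 0" using total_degree_mult[of p q] q by simp
next
  assume p: "p \<noteq> 0 \<and> total_degree p = 0"
  then have "p = [:[:coeff (coeff p 0) 0:]:]" using total_degree_0_imp_const by blast
  with p have "coeff (coeff p 0) 0 \<noteq> 0" by (metis pCons_0_0)
  then have "[:[:coeff (coeff p 0) 0:]:] dvd 1"
    by (simp add: is_unit_const_poly_iff is_unit_pCons_iff)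
  then show "p dvd 1" using \<open>p = _\<close> by simp
qed

lemma eval2_on_line: "eval2 p (x, poly [:c, t:] x) = poly (poly p [:c, t:]) x"
  by (induction p) (auto simp: eval2_def algebra_simps)

section \<open>Interpolation by polynomials of bounded degree\<close>

text \<open>The dimension of \<^term>\<open>Pi_deg (int n - 1)\<close>. The shift by one makes \<open>n = 0\<close> the zero space.\<close>

definition dim_Pi :: "nat \<Rightarrow> nat" where
  "dim_Pi n = n * (n + 1) div 2"

lemma two_dim_Pi: "2 * dim_Pi n = n * (n + 1)"
  by (simp add: dim_Pi_def)

text \<open>The pair \<open>(i, j)\<close> stands for the monomial \<open>x\<^sup>j y\<^sup>i\<close>.\<close>

definition triangle :: "nat \<Rightarrow> (nat \<times> nat) set" where
  "triangle n = {(i, j). i + j < n}"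

lemma finite_triangle [simp]: "finite (triangle n)"
  by (rule finite_subset[of _ "{..<n} \<times> {..<n}"]) (auto simp: triangle_def)

lemma card_triangle: "card (triangle n) = dim_Pi n"
proof -
  have "triangle n = (SIGMA i:{..<n}. {..<n - i})" by (auto simp: triangle_def)
  then have "card (triangle n) = (\<Sum>i<n. n - i)" by simp
  also have "2 * \<dots> = n * (n + 1)"
  proof (induction n)
    case (Suc n)
    have "(\<Sum>i<Suc n. Suc n - i) = Suc n + (\<Sum>i<n. n - i)" 
      by (subst sum.lessThan_Suc_shift) simp
    then show ?case using Suc by (simp add: algebra_simps)
  qed simp
  finally show ?thesis by (simp add: dim_Pi_def)
qed

definition poly_of :: "nat \<Rightarrow> (nat \<times> nat \<Rightarrow> complex) \<Rightarrow> bipoly" where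
  "poly_of n c = (\<Sum>ij\<in>triangle n. smult [:c ij:] (monom (monom 1 (snd ij)) (fst ij)))"

lemma coeff_poly_of: "coeff (coeff (poly_of n c) i) j = (if i + j < n then c (i, j) else 0)"
proof -
  have "coeff (coeff (poly_of n c) i) j = (\<Sum>ij\<in>triangle n. if ij = (i, j) then c (i, j) else 0)"
    unfolding poly_of_def coeff_sum by (rule sum.cong) (auto split: prod.splits)
  also have "\<dots> = (if (i, j) \<in> triangle n then c (i, j) else 0)"
    by (rule sum.delta) simp
  finally show ?thesis by (simp add: triangle_def)
qed

lemma poly_of_in_Pi_deg: "poly_of n c \<in> Pi_deg (int n - 1)"
  by (auto simp: mem_Pi_deg_iff coeff_poly_of split: if_splits)

lemma poly_of_coeffs:
  assumes "q \<in> Pi_deg (int n - 1)"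
  shows "poly_of n (\<lambda>(i, j). coeff (coeff q i) j) = q"
  using assms by (intro poly_eqI) (force simp: coeff_poly_of mem_Pi_deg_iff)

lemma eval2_poly_of:
  "eval2 (poly_of n c) A = (\<Sum>ij\<in>triangle n. c ij * (fst A ^ snd ij * snd A ^ fst ij))"
  unfolding poly_of_def by (simp, simp add: eval2_def poly_monom)

lemma vanishing_poly_exists:
  assumes "finite S" "card S < dim_Pi n"
  obtains q where "q \<in> Pi_deg (int n - 1)" "q \<noteq> 0" "\<forall>A\<in>S. eval2 q A = 0"
proof -
  obtain c where c: "\<exists>ij\<in>triangle n. c ij \<noteq> 0"
    "\<forall>A\<in>S. (\<Sum>ij\<in>triangle n. c ij * (fst A ^ snd ij * snd A ^ fst ij)) = 0"
    using homogeneous_system[OF assms(1) finite_triangle[of n], of "\<lambda>A ij. fst A ^ snd ij * snd A ^ fst ij"]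
      assms(2) by (auto simp: card_triangle)
  from c(1) have "poly_of n c \<noteq> 0"
    unfolding triangle_def by clarsimp (metis coeff_0 coeff_poly_of)
  with c(2) show ?thesis by (intro that[OF poly_of_in_Pi_deg]) (auto simp: eval2_poly_of)
qed

lemma fundamental_polyI:
  assumes "q \<in> Pi_deg k" "\<forall>B\<in>X - {A}. eval2 q B = 0" "eval2 q A \<noteq> 0"
  shows "\<exists>p. fundamental_poly k X A p"
  using assms unfolding fundamental_poly_def
  by (intro exI[of _ "smult [:inverse (eval2 q A):] q"]) (simp add: Pi_deg_smult)

lemma card_independent_le:
  assumes "finite B" "independent_pts (int n - 1) B"
  shows "card B \<le> dim_Pi n"
proof (rule ccontr)
  assume "\<not> card B \<le> dim_Pi n"
  then obtain c where c: "\<exists>A\<in>B. c A \<noteq> 0"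
    "\<forall>ij\<in>triangle n. (\<Sum>A\<in>B. c A * (fst A ^ snd ij * snd A ^ fst ij)) = 0"
    using homogeneous_system[OF finite_triangle[of n] assms(1), of "\<lambda>ij A. fst A ^ snd ij * snd A ^ fst ij"]
    by (auto simp: card_triangle)
  obtain A where A: "A \<in> B" "c A \<noteq> 0" using c(1) by blast
  then obtain p where p: "p \<in> Pi_deg (int n - 1)" "eval2 p A = 1" "\<forall>C\<in>B - {A}. eval2 p C = 0"
    using assms(2) by (auto simp: independent_pts_def fundamental_poly_def)
  obtain d where d: "p = poly_of n d" using poly_of_coeffs[OF p(1)] by metis
  have "(\<Sum>C\<in>B. c C * eval2 p C) = 
      (\<Sum>C\<in>B. \<Sum>ij\<in>triangle n. d ij * (c C * (fst C ^ snd ij * snd C ^ fst ij)))"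
    by (simp add: d eval2_poly_of sum_distrib_left mult_ac)
  also have "\<dots> = (\<Sum>ij\<in>triangle n. d ij * (\<Sum>C\<in>B. c C * (fst C ^ snd ij * snd C ^ fst ij)))"
    by (subst sum.swap) (simp add: sum_distrib_left)
  also have "\<dots> = 0" using c(2) by simp
  finally have "(\<Sum>C\<in>B. c C * eval2 p C) = 0" .
  moreover have "(\<Sum>C\<in>B. c C * eval2 p C) = (\<Sum>C\<in>{A}. c C * eval2 p C)"
    using A p assms(1) by (intro sum.mono_neutral_right) auto
  ultimately show False using A p by simp
qed

text \<open>Fundamental polynomials of the old points are corrected by a multiple of \<open>q\<close>, which does not
  change them on \<open>B\<close>.\<close>

lemma independent_pts_insert:
  assumes "independent_pts k B" "q \<in> Pi_deg k" "\<forall>C\<in>B. eval2 q C = 0" "eval2 q A \<noteq> 0"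
  shows "independent_pts k (insert A B)"
  unfolding independent_pts_def
proof
  fix C assume C: "C \<in> insert A B"
  show "\<exists>p. fundamental_poly k (insert A B) C p"
  proof (cases "C = A")
    case True
    then show ?thesis using assms by (intro fundamental_polyI[of q]) auto
  next
    case False
    with C assms(1) obtain p where p: "p \<in> Pi_deg k" "eval2 p C = 1" "\<forall>D\<in>B - {C}. eval2 p D = 0"
      by (auto simp: independent_pts_def fundamental_poly_def)
    let ?p = "p - smult [:eval2 p A / eval2 q A:] q"
    have "eval2 ?p C = 1" "\<forall>D\<in>insert A B - {C}. eval2 ?p D = 0"
      using p assms(3,4) C False by auto
    then show ?thesis using p(1) assms(2)
      by (intro fundamental_polyI[of ?p] Pi_deg_diff Pi_deg_smult) auto
  qed
qed

text \<open>Sets of points behave like sets of vectors here: a maximal independent set \<open>B\<close> between \<open>S\<close> and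
  \<open>D\<close> is a basis of the conditions that the points of \<open>D\<close> impose. It is finite even when \<open>D\<close> is not.\<close>

lemma independent_subset_extends:
  assumes "S \<subseteq> D" "finite S" "independent_pts (int n - 1) S"
  obtains B where "S \<subseteq> B" "B \<subseteq> D" "finite B" "independent_pts (int n - 1) B" "card B \<le> dim_Pi n"
    "\<forall>q\<in>Pi_deg (int n - 1). (\<forall>C\<in>B. eval2 q C = 0) \<longrightarrow> (\<forall>A\<in>D. eval2 q A = 0)"
proof -
  let ?P = "\<lambda>B. S \<subseteq> B \<and> B \<subseteq> D \<and> finite B \<and> independent_pts (int n - 1) B"
  have S: "?P S" using assms by auto
  have bound: "\<forall>B. ?P B \<longrightarrow> card B < Suc (dim_Pi n)" by (simp add: card_independent_le less_Suc_eq_le)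
  obtain B where "?P B \<and> (\<forall>B'. ?P B' \<longrightarrow> card B' \<le> card B)"
    by (rule exE[OF Lattices_Big.ex_has_greatest_nat[of ?P S card, OF S bound]])
  then have B: "?P B" and max: "\<forall>B'. ?P B' \<longrightarrow> card B' \<le> card B"
    by (rule conjunct1, rule conjunct2)
  have "eval2 q A = 0" if q: "q \<in> Pi_deg (int n - 1)" "\<forall>C\<in>B. eval2 q C = 0" "A \<in> D" for q A
  proof (rule ccontr)
    assume ne: "eval2 q A \<noteq> 0"
    then have "A \<notin> B" using q by blast
    moreover have "?P (insert A B)"
      using B q independent_pts_insert[of "int n - 1" B q A] ne by auto
    ultimately have "card (insert A B) \<le> card B" using max by (simp only:)
    with \<open>A \<notin> B\<close> B show False by simp
  qed
  with B card_independent_le[of B n] show ?thesis by (intro that[of B]) simp_all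
qed

lemma Pi_deg_prod:
  assumes "\<And>i. i \<in> I \<Longrightarrow> f i \<in> Pi_deg 1"
  shows "(\<Prod>i\<in>I. f i) \<in> Pi_deg (int (card I))"
  using assms
proof (induction I rule: infinite_finite_induct)
  case (insert i I)
  then have "f i * prod f I \<in> Pi_deg (1 + int (card I))" by (intro Pi_deg_mult) auto
  then show ?case using insert by simp
qed (auto intro: one_in_Pi_deg)

lemma separating_line:
  assumes "A \<noteq> B"
  obtains l where "l \<in> Pi_deg 1" "eval2 l B = 0" "eval2 l A \<noteq> 0"
proof (cases "fst A = fst B")
  case True
  with assms have "snd A \<noteq> snd B" by (simp add: prod_eq_iff)
  then show ?thesis
    by (intro that[of "[:[:- snd B:], 1:]"])
       (auto simp: mem_Pi_deg_iff eval2_def coeff_pCons one_pCons split: nat.splits)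
next
  case False
  then show ?thesis
    by (intro that[of "[:[:- fst B, 1:]:]"])
       (auto simp: mem_Pi_deg_iff eval2_def coeff_pCons split: nat.splits)
qed

text \<open>A product of lines through the other points, none of them through \<open>A\<close>, separates \<open>A\<close>.\<close>

lemma independent_pts_if_card_le:
  assumes "finite S" "card S \<le> n"
  shows "independent_pts (int n - 1) S"
  unfolding independent_pts_def
proof
  fix A assume A: "A \<in> S"
  have "\<forall>B\<in>S - {A}. \<exists>l. l \<in> Pi_deg 1 \<and> eval2 l B = 0 \<and> eval2 l A \<noteq> 0"
  proof
    fix B assume "B \<in> S - {A}"
    then have "A \<noteq> B" by blast
    from separating_line[OF this] show "\<exists>l. l \<in> Pi_deg 1 \<and> eval2 l B = 0 \<and> eval2 l A \<noteq> 0" by metis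
  qed
  then obtain l where l: "\<forall>B\<in>S - {A}. l B \<in> Pi_deg 1 \<and> eval2 (l B) B = 0 \<and> eval2 (l B) A \<noteq> 0"
    by metis
  have "card (S - {A}) = card S - 1" "card S > 0" using A assms(1) by (auto simp: card_gt_0_iff)
  then have "(\<Prod>B\<in>S - {A}. l B) \<in> Pi_deg (int n - 1)"
    using l assms(2) by (intro Pi_deg_mono[OF Pi_deg_prod]) auto
  moreover have "\<forall>C\<in>S - {A}. eval2 (\<Prod>B\<in>S - {A}. l B) C = 0"
  proof
    fix C assume "C \<in> S - {A}"
    then show "eval2 (\<Prod>B\<in>S - {A}. l B) C = 0"
      using l assms(1) prod_zero[of "S - {A}" "\<lambda>B. eval2 (l B) C"] by auto
  qed
  moreover have "eval2 (\<Prod>B\<in>S - {A}. l B) A \<noteq> 0"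
    using l assms(1) by simp
  ultimately show "\<exists>p. fundamental_poly (int n - 1) S A p"
    by (rule fundamental_polyI)
qed

section \<open>Common zeros of coprime polynomials\<close>

lemma eq_0_if_vanishes_everywhere:
  assumes "\<And>A. eval2 p A = 0"
  shows "p = 0"
proof (rule ccontr)
  assume "p \<noteq> 0"
  then have fin: "finite {t. \<exists>c. coeff (poly p [:c, t:]) (total_degree p) = 0}"
    by (rule finite_asymptotic_slopes)
  obtain t where "t \<notin> {t. \<exists>c. coeff (poly p [:c, t:]) (total_degree p) = 0}"
    by (rule exE[OF ex_new_if_finite[OF infinite_UNIV_char_0 fin]])
  then have "poly p [:0, t:] \<noteq> 0" by (metis (mono_tags, lifting) coeff_0 mem_Collect_eq)
  moreover have "poly (poly p [:0, t:]) x = 0" for x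
    using assms eval2_on_line[of p x 0 t] by metis
  ultimately show False using poly_all_0_iff_0 by blast
qed

text \<open>Bezout's inequality for distinct points. If \<open>S\<close> had more than \<open>ab\<close> points, extend it to a
  unisolvent set \<open>U\<close> for polynomials of degree less than \<open>n = a + b + card S\<close>. Since \<open>p u + q v\<close>
  vanishes on \<open>S\<close> anyway, to make it vanish identically costs only \<open>card U - card S\<close> conditions on
  \<open>u\<close> and \<open>v\<close>. Further conditions on \<open>v\<close>, at points \<open>W\<close> off \<open>p = 0\<close>, exclude the multiples of \<open>p\<close>,
  which are the trivial solutions \<open>v = p w\<close>, \<open>u = - q w\<close>. The number of unknowns still exceeds the
  number of equations.\<close>

lemma bezout_finite:
  assumes "coprime p q" "p \<noteq> 0" "q \<noteq> 0" "finite S"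
    and S: "\<And>A. A \<in> S \<Longrightarrow> eval2 p A = 0 \<and> eval2 q A = 0"
  shows "card S \<le> total_degree p * total_degree q"
proof (rule ccontr)
  define a b m where "a = total_degree p" and "b = total_degree q" and "m = card S"
  define n where "n = a + b + m"
  assume "\<not> card S \<le> total_degree p * total_degree q"
  then have large: "a * b < m" by (simp add: a_def b_def m_def)
  have "independent_pts (int n - 1) S"
    using assms(4) by (rule independent_pts_if_card_le) (simp add: n_def m_def)
  from independent_subset_extends[OF subset_UNIV assms(4) this]
  obtain U where U: "S \<subseteq> U" "U \<subseteq> UNIV" "finite U" "independent_pts (int n - 1) U" "card U \<le> dim_Pi n"
    "\<forall>f\<in>Pi_deg (int n - 1). (\<forall>C\<in>U. eval2 f C = 0) \<longrightarrow> (\<forall>A\<in>UNIV. eval2 f A = 0)" .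
  have "independent_pts (int m - 1) {}" by (simp add: independent_pts_def)
  from independent_subset_extends[OF empty_subsetI finite.emptyI this, of "{A. eval2 p A \<noteq> 0}"]
  obtain W where W: "{} \<subseteq> W" "W \<subseteq> {A. eval2 p A \<noteq> 0}" "finite W"
    "independent_pts (int m - 1) W" "card W \<le> dim_Pi m"
    "\<forall>f\<in>Pi_deg (int m - 1). (\<forall>C\<in>W. eval2 f C = 0) \<longrightarrow> (\<forall>A\<in>{A. eval2 p A \<noteq> 0}. eval2 f A = 0)" .
  define x where "x A ij = fst A ^ snd ij * snd A ^ fst ij" for A :: "complex \<times> complex" and ij :: "nat \<times> nat"
  \<comment> \<open>The unknowns are the coefficients of \<open>u\<close> and \<open>v\<close>. An equation \<open>Inl A\<close> states that
    \<open>p u + q v\<close> vanishes at \<open>A\<close>, an equation \<open>Inr A\<close> that \<open>v\<close> does.\<close>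
  define I where "I = triangle (b + m) <+> triangle (a + m)"
  define J where "J = (U - S) <+> W"
  define M where "M j i = (case j of
      Inl A \<Rightarrow> (case i of Inl ij \<Rightarrow> eval2 p A * x A ij | Inr ij \<Rightarrow> eval2 q A * x A ij)
    | Inr A \<Rightarrow> (case i of Inl ij \<Rightarrow> 0 | Inr ij \<Rightarrow> x A ij))" for j i
  have "m \<le> card U" using U by (simp add: m_def card_mono)
  then have "card J + m = card U + card W"
    using U W assms(4) by (simp add: J_def m_def card_Plus card_Diff_subset)
  moreover have "card I = dim_Pi (b + m) + dim_Pi (a + m)"
    by (simp add: I_def card_Plus card_triangle)
  moreover have "dim_Pi (b + m) + dim_Pi (a + m) + a * b = dim_Pi n + dim_Pi m"
  proof -
    have "2 * (dim_Pi (b + m) + dim_Pi (a + m) + a * b) = 2 * (dim_Pi n + dim_Pi m)"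
    unfolding distrib_left two_dim_Pi n_def by (simp add: algebra_simps)
    then show ?thesis by (simp only: mult_cancel_left) simp
  qed
  ultimately have "card J < card I" using U(5) W(5) large by linarith
  moreover have "finite J" "finite I" using U W by (auto simp: I_def J_def)
  ultimately obtain c where c: "\<exists>i\<in>I. c i \<noteq> 0" "\<forall>j\<in>J. (\<Sum>i\<in>I. c i * M j i) = 0"
    using homogeneous_system[of J I M] by blast
  define u v where "u = poly_of (b + m) (c \<circ> Inl)" and "v = poly_of (a + m) (c \<circ> Inr)"
  have ev: "eval2 u A = (\<Sum>ij\<in>triangle (b + m). c (Inl ij) * x A ij)"
    "eval2 v A = (\<Sum>ij\<in>triangle (a + m). c (Inr ij) * x A ij)" for A
    by (simp_all add: u_def v_def eval2_poly_of x_def)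
  have sum_I: "(\<Sum>i\<in>I. f i) = (\<Sum>ij\<in>triangle (b + m). f (Inl ij)) + (\<Sum>ij\<in>triangle (a + m). f (Inr ij))"
    for f :: "_ \<Rightarrow> complex"
    unfolding I_def by (simp add: sum.Plus)
  have rel: "eval2 (p * u + q * v) A = 0" if "A \<in> U" for A
  proof (cases "A \<in> S")
    case False
    with that have "Inl A \<in> J" unfolding J_def by (intro InlI) auto
    with c(2) have "(\<Sum>i\<in>I. c i * M (Inl A) i) = 0" by blast
    then show ?thesis unfolding sum_I by (simp add: ev M_def sum_distrib_left mult_ac)
  qed (use S in simp)
  have v_W: "eval2 v A = 0" if "A \<in> W" for A
  proof -
    from that have "Inr A \<in> J" unfolding J_def by (intro InrI)
    with c(2) have "(\<Sum>i\<in>I. c i * M (Inr A) i) = 0" by blast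
    then show ?thesis unfolding sum_I by (simp add: ev M_def)
  qed
  have "p * u \<in> Pi_deg (int a + (int (b + m) - 1))" "q * v \<in> Pi_deg (int b + (int (a + m) - 1))"
    unfolding u_def v_def a_def b_def by (intro Pi_deg_mult in_Pi_deg_total_degree poly_of_in_Pi_deg)+
  then have "p * u + q * v \<in> Pi_deg (int n - 1)"
    by (intro Pi_deg_add) (simp_all add: n_def algebra_simps)
  with U(6) rel have "eval2 (p * u + q * v) A = 0" for A by blast
  then have eq: "p * u + q * v = 0" by (rule eq_0_if_vanishes_everywhere)
  then have "q * v = p * (- u)" by (simp add: add_eq_0_iff)
  then have "p dvd v" using assms(1) by (metis coprime_dvd_mult_right_iff dvd_triv_left)
  then obtain w where w: "v = p * w" by (elim dvdE)
  have "v \<in> Pi_deg (int (a + m) - 1)" unfolding v_def by (rule poly_of_in_Pi_deg)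
  then have "w \<in> Pi_deg (int m - 1)"
    using Pi_deg_mult_cancel[of p w] assms(2) by (force simp: w a_def)
  moreover have "\<forall>A\<in>W. eval2 w A = 0"
    using v_W W(2) by (auto simp: w)
  ultimately have "eval2 w A = 0" if "eval2 p A \<noteq> 0" for A
    using W(6) that by blast
  then have "eval2 v A = 0" for A
    by (cases "eval2 p A = 0") (simp_all add: w)
  then have v0: "v = 0" by (rule eq_0_if_vanishes_everywhere)
  with eq assms(2) have u0: "u = 0" by simp
  have "c i = 0" if "i \<in> I" for i
  proof (cases i)
    case (Inl ij)
    then show ?thesis using that u0 coeff_poly_of[of "b + m" "c \<circ> Inl" "fst ij" "snd ij"]
      by (auto simp: I_def u_def triangle_def)
  next
    case (Inr ij)
    then show ?thesis using that v0 coeff_poly_of[of "a + m" "c \<circ> Inr" "fst ij" "snd ij"]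
      by (auto simp: I_def v_def triangle_def)
  qed
  with c(1) show False by blast
qed

lemma bezout:
  assumes "coprime p q" "p \<noteq> 0" "q \<noteq> 0"
  shows "finite {A. eval2 p A = 0 \<and> eval2 q A = 0}"
    and "card {A. eval2 p A = 0 \<and> eval2 q A = 0} \<le> total_degree p * total_degree q"
proof -
  have "card G \<le> total_degree p * total_degree q"
    if "G \<subseteq> {A. eval2 p A = 0 \<and> eval2 q A = 0}" "finite G" for G
    using that by (intro bezout_finite[OF assms]) auto
  from finite_if_finite_subsets_card_bdd[OF this]
  show "finite {A. eval2 p A = 0 \<and> eval2 q A = 0}"
    and "card {A. eval2 p A = 0 \<and> eval2 q A = 0} \<le> total_degree p * total_degree q" by auto
qed

text \<open>The Bezout identity with degree control: the factor of \<open>Q\<close> is reduced modulo \<open>P\<close>.\<close>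

lemma univariate_bezout_degrees:
  fixes P Q w :: "complex poly"
  assumes "coprime P Q" "P \<noteq> 0" "degree Q \<le> b" "degree w \<le> d" "degree P + b \<le> d + 1"
  obtains u v where "w = u * P + v * Q" "u = 0 \<or> degree u + degree P \<le> d" "v = 0 \<or> degree v + b \<le> d"
proof -
  obtain r s where rs: "r * P + s * Q = 1"
    using assms(1) by (metis bezout_coefficients_fst_snd coprime_iff_gcd_eq_1)
  define v where "v = w * s mod P"
  define u where "u = w * r + (w * s div P) * Q"
  have "w = w * (r * P + s * Q)" using rs by simp
  also have "\<dots> = w * r * P + w * s * Q"
    by (simp add: algebra_simps)
  also have "\<dots> = w * r * P + (w * s div P * P + w * s mod P) * Q"
    by (simp only: div_mult_mod_eq)
  also have "\<dots> = u * P + v * Q" unfolding u_def v_def by (simp only: ring_distribs mult_ac add_ac)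
  finally have eq: "w = u * P + v * Q" .
  have v: "v = 0 \<or> degree v < degree P" 
    unfolding v_def using assms(2) degree_mod_less by blast
  then have "degree (v * Q) \<le> d"
    using degree_mult_le[of v Q] assms(3,5) by auto
  then have "degree (w - v * Q) \<le> d" using assms(4) by (intro degree_diff_le)
  then have "u = 0 \<or> degree u + degree P \<le> d"
    using eq assms(2) degree_mult_eq[of u P] by (cases "u = 0") simp_all
  then show ?thesis using that eq v assms(5) by fastforce
qed

lemma poly_of_x_in_Pi_deg: "u = 0 \<or> int (degree u) \<le> k \<Longrightarrow> [:u:] \<in> Pi_deg k"
  using le_degree[of u] by (force simp: mem_Pi_deg_iff coeff_pCons split: nat.splits)

text \<open>On the line \<open>y = c + t x\<close> the restriction of \<open>F\<close> is a combination of those of \<open>p\<close> and \<open>q\<close> with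
  factors that are polynomials in \<open>x\<close> alone; subtracting this combination from \<open>F\<close> makes it
  divisible by the equation of the line. So modulo \<open>p\<close> and \<open>q\<close> a polynomial of degree \<open>k + 1\<close> is a
  line times a polynomial of degree \<open>k\<close>.\<close>

lemma divide_by_line:
  assumes F: "F \<in> Pi_deg (int k + 1)" and p: "coeff (poly p [:c, t:]) (total_degree p) \<noteq> 0"
    and cop: "coprime (poly p [:c, t:]) (poly q [:c, t:])"
    and k: "total_degree p + total_degree q \<le> k + 2"
  obtains u v g where "F = u * p + v * q + [:- [:c, t:], 1:] * g" "g \<in> Pi_deg (int k)"
proof -
  let ?l = "[:- [:c, t:], 1:]"
  have dp: "degree (poly p [:c, t:]) = total_degree p" and p0: "poly p [:c, t:] \<noteq> 0"
    using p le_degree degree_restrict_le[of p c t] by (auto intro: antisym)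
  have "degree (poly F [:c, t:]) \<le> k + 1"
    using F degree_restrict_le[of F c t] by (auto simp: Pi_deg_def)
  then obtain u v where uv: "poly F [:c, t:] = u * poly p [:c, t:] + v * poly q [:c, t:]"
    "u = 0 \<or> degree u + total_degree p \<le> k + 1" "v = 0 \<or> degree v + total_degree q \<le> k + 1"
    using univariate_bezout_degrees[OF cop p0 degree_restrict_le[of q c t], of "poly F [:c, t:]" "k + 1"]
      k dp by auto
  define R where "R = F - ([:u:] * p + [:v:] * q)"
  have "poly R [:c, t:] = 0" using uv(1) by (simp add: R_def)
  then obtain g where g: "R = ?l * g" by (metis dvdE poly_eq_0_iff_dvd)
  have "[:u:] * p \<in> Pi_deg (int k + 1 - int (total_degree p) + int (total_degree p))"
    "[:v:] * q \<in> Pi_deg (int k + 1 - int (total_degree q) + int (total_degree q))"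
    using uv by (intro Pi_deg_mult in_Pi_deg_total_degree poly_of_x_in_Pi_deg; auto)+
  then have "R \<in> Pi_deg (int k + 1)"
    unfolding R_def using F by (intro Pi_deg_diff Pi_deg_add) simp_all
  moreover have l0: "?l \<noteq> 0" by simp
  moreover have "total_degree ?l \<ge> 1" 
  proof (rule ccontr)
    assume "\<not> ?thesis"
    then have "coeff (coeff ?l 1) 0 = 0" by (intro coeff_coeff_eq_0) simp
    then show False by simp
  qed
  ultimately have "g \<in> Pi_deg (int k)"
    using Pi_deg_mult_cancel[of ?l g "int k + 1"] by (auto simp: g elim!: Pi_deg_mono)
  then show ?thesis using that[of "[:u:]" "[:v:]" g] g by (simp add: R_def algebra_simps)
qed

text \<open>All large degrees make \<open>S\<close> independent. To descend from degree \<open>l + 1\<close> to \<open>l\<close>, divide a fundamental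
  polynomial by a line: modulo \<open>p\<close> and \<open>q\<close>, which vanish on \<open>S\<close>, this is possible, and the line can
  be chosen to avoid all common zeros.\<close>

lemma complete_intersection_independent:
  assumes cop: "coprime p q" "p \<noteq> 0" "q \<noteq> 0" and "finite S"
    and S: "\<And>A. A \<in> S \<Longrightarrow> eval2 p A = 0 \<and> eval2 q A = 0"
    and k: "total_degree p + total_degree q \<le> k + 2"
  shows "independent_pts (int k) S"
proof -
  let ?Z = "{A. eval2 p A = 0 \<and> eval2 q A = 0}"
  have fin: "finite {t. \<exists>c. coeff (poly p [:c, t:]) (total_degree p) = 0}"
    by (rule finite_asymptotic_slopes) fact
  obtain t where "t \<notin> {t. \<exists>c. coeff (poly p [:c, t:]) (total_degree p) = 0}"
    by (rule exE[OF ex_new_if_finite[OF infinite_UNIV_char_0 fin]])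
  then have t: "coeff (poly p [:c, t:]) (total_degree p) \<noteq> 0" for c by blast
  have fin': "finite ((\<lambda>A. snd A - t * fst A) ` ?Z)" using bezout(1)[OF cop] by simp
  \<comment> \<open>A line with a slope \<open>t\<close> of full degree for \<open>p\<close> that misses all common zeros, so that \<open>p\<close> and
    \<open>q\<close> have coprime restrictions.\<close>
  obtain c where c: "c \<notin> (\<lambda>A. snd A - t * fst A) ` ?Z"
    by (rule exE[OF ex_new_if_finite[OF infinite_UNIV_char_0 fin']])
  have "poly (poly q [:c, t:]) x \<noteq> 0" if "poly (poly p [:c, t:]) x = 0" for x
  proof
    assume "poly (poly q [:c, t:]) x = 0"
    with that have "(x, poly [:c, t:] x) \<in> ?Z" by (simp only: eval2_on_line mem_Collect_eq simp_thms)
    then have "snd (x, poly [:c, t:] x) - t * fst (x, poly [:c, t:] x) \<in> (\<lambda>A. snd A - t * fst A) ` ?Z"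
      by (rule imageI)
    with c show False by simp
  qed
  moreover have "poly p [:c, t:] \<noteq> 0" using t[of c] by auto
  ultimately have cop_l: "coprime (poly p [:c, t:]) (poly q [:c, t:])"
    by (intro coprime_if_no_common_root)
  have line: "eval2 [:- [:c, t:], 1:] A \<noteq> 0" if "A \<in> S" for A
  proof
    assume "eval2 [:- [:c, t:], 1:] A = 0"
    then have "c = snd A - t * fst A" by (simp add: eval2_def algebra_simps)
    then show False using c S[OF that] by blast
  qed
  have step: "independent_pts (int l) S" if kl: "k \<le> l" and indep: "independent_pts (int (Suc l)) S" for l
    unfolding independent_pts_def
  proof
    fix A assume A: "A \<in> S"
    then obtain F where F: "F \<in> Pi_deg (int l + 1)" "eval2 F A = 1" "\<forall>B\<in>S - {A}. eval2 F B = 0"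
      using indep by (auto simp: independent_pts_def fundamental_poly_def add.commute)
    have "total_degree p + total_degree q \<le> l + 2" using k kl by simp
    from divide_by_line[OF F(1) t cop_l this] obtain u v g where
      g: "F = u * p + v * q + [:- [:c, t:], 1:] * g" "g \<in> Pi_deg (int l)" .
    have "eval2 F B = eval2 [:- [:c, t:], 1:] B * eval2 g B" if "B \<in> S" for B
      using S[OF that] unfolding g(1) by (simp only: eval2_simps) simp
    then show "\<exists>p. fundamental_poly (int l) S A p"
      using F A line g(2) by (intro fundamental_polyI[of g]) auto
  qed
  have descend: "independent_pts (int k) S" if "independent_pts (int (k + j)) S" for j
    using that
  proof (induction j)
    case (Suc j)
    then have "independent_pts (int (Suc (k + j))) S" by simp
    then have "independent_pts (int (k + j)) S" by (rule step[OF le_add1])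
    then show ?case by (rule Suc.IH)
  qed simp
  have "independent_pts (int (k + card S)) S"
    using independent_pts_if_card_le[OF assms(4), of "Suc (k + card S)"] by simp
  then show ?thesis by (rule descend)
qed

section \<open>Essentially dependent sets\<close>

lemma essentially_dependentD:
  assumes "essentially_dependent k Y" "A \<in> Y" "q \<in> Pi_deg k" "\<forall>B\<in>Y - {A}. eval2 q B = 0"
  shows "eval2 q A = 0"
  using assms fundamental_polyI[of q k Y A] by (auto simp: essentially_dependent_def)

text \<open>Multiplication by \<open>G\<close> turns a fundamental polynomial of degree \<open>k - e\<close> for the smaller set into
  one of degree \<open>k\<close> for \<open>Y\<close>, up to a nonzero constant.\<close>

lemma essentially_dependent_off_curve:
  assumes "essentially_dependent k Y"
  shows "essentially_dependent (k - int (total_degree G)) {A \<in> Y. eval2 G A \<noteq> 0}"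
  unfolding essentially_dependent_def
proof (intro ballI notI)
  fix A assume A: "A \<in> {A \<in> Y. eval2 G A \<noteq> 0}"
  assume "\<exists>p. fundamental_poly (k - int (total_degree G)) {A \<in> Y. eval2 G A \<noteq> 0} A p"
  then obtain f where f: "f \<in> Pi_deg (k - int (total_degree G))" "eval2 f A = 1"
    "\<forall>B\<in>{A \<in> Y. eval2 G A \<noteq> 0} - {A}. eval2 f B = 0"
    by (auto simp: fundamental_poly_def)
  have "f * G \<in> Pi_deg (k - int (total_degree G) + int (total_degree G))"
    using f(1) in_Pi_deg_total_degree by (rule Pi_deg_mult)
  moreover have "\<forall>B\<in>Y - {A}. eval2 (f * G) B = 0" using f(3) by auto
  ultimately have "eval2 (f * G) A = 0" using A by (intro essentially_dependentD[OF assms]) auto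
  with f(2) A show False by simp
qed

text \<open>At \<open>A \<in> B\<close>, multiply \<open>q\<close> by the \<open>i\<close>-fundamental polynomial \<open>f\<close> of \<open>A\<close> with respect to \<open>B\<close>: the
  product vanishes at all points of \<open>Y\<close> except possibly \<open>A\<close>, hence also at \<open>A\<close>, where \<open>f\<close> is \<open>1\<close>.\<close>

lemma vanish_off_independent_imp_vanish:
  assumes "essentially_dependent k Y" "B \<subseteq> Y" "independent_pts i B" "q \<in> Pi_deg (k - i)"
    and q: "\<forall>A\<in>Y - B. eval2 q A = 0"
  shows "\<forall>A\<in>Y. eval2 q A = 0"
proof
  fix A assume A: "A \<in> Y"
  show "eval2 q A = 0"
  proof (cases "A \<in> B")
    case True
    with assms(3) obtain f where f: "f \<in> Pi_deg i" "eval2 f A = 1" "\<forall>C\<in>B - {A}. eval2 f C = 0"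
      by (auto simp: independent_pts_def fundamental_poly_def)
    have "f * q \<in> Pi_deg (i + (k - i))" using f(1) assms(4) by (rule Pi_deg_mult)
    moreover have "\<forall>C\<in>Y - {A}. eval2 (f * q) C = 0" using f(3) q by auto
    ultimately have "eval2 (f * q) A = 0" using A by (intro essentially_dependentD[OF assms(1)]) auto
    with f(2) show ?thesis by simp
  qed (use A q in blast)
qed

definition least_degree_poly :: "bipoly \<Rightarrow> (complex \<times> complex) set \<Rightarrow> bool" where
  "least_degree_poly p Y \<longleftrightarrow> p \<noteq> 0 \<and> (\<forall>A\<in>Y. eval2 p A = 0) \<and>
     (\<forall>q. q \<noteq> 0 \<longrightarrow> (\<forall>A\<in>Y. eval2 q A = 0) \<longrightarrow> total_degree p \<le> total_degree q)"

lemma least_degree_polyD: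
  assumes "least_degree_poly p Y"
  shows "p \<noteq> 0" "\<And>A. A \<in> Y \<Longrightarrow> eval2 p A = 0"
    "\<And>q. q \<noteq> 0 \<Longrightarrow> (\<And>A. A \<in> Y \<Longrightarrow> eval2 q A = 0) \<Longrightarrow> total_degree p \<le> total_degree q"
  using assms by (auto simp: least_degree_poly_def)

lemma least_degree_poly_exists:
  assumes "finite Y"
  obtains p where "least_degree_poly p Y"
proof -
  let ?P = "\<lambda>p. p \<noteq> 0 \<and> (\<forall>A\<in>Y. eval2 p A = 0)"
  have "card Y < dim_Pi (Suc (card Y))"
    using two_dim_Pi[of "Suc (card Y)"] by simp
  with assms obtain q where "?P q" by (metis vanishing_poly_exists)
  from ex_has_least_nat[of ?P q total_degree, OF this] show ?thesis
    using that unfolding least_degree_poly_def by blast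
qed

text \<open>Dropping one copy of a repeated factor keeps the zero set and lowers the degree.\<close>

lemma least_degree_poly_squarefree:
  assumes "least_degree_poly p Y"
  shows "squarefree p"
proof (rule squarefreeI)
  fix f assume "f ^ 2 dvd p"
  then obtain g where "p = f ^ 2 * g" by (elim dvdE)
  then have g: "p = f * (f * g)" by (simp add: power2_eq_square mult.assoc)
  with least_degree_polyD(1)[OF assms] have nz: "f \<noteq> 0" "f * g \<noteq> 0" by auto
  have "total_degree p \<le> total_degree (f * g)"
    using least_degree_polyD(2)[OF assms] nz by (intro least_degree_polyD(3)[OF assms]) (auto simp: g)
  then have "total_degree f = 0" using nz by (simp add: g total_degree_mult)
  then show "f dvd 1" using nz by (simp add: is_unit_iff_total_degree)
qed

text \<open>With \<open>G = gcd p q\<close> of degree \<open>e\<close>, the part of \<open>Y\<close> off \<open>G = 0\<close> consists of common zeros of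
  \<open>p / G\<close> and \<open>q / G\<close>. Their degrees add up to \<open>deg p + deg q - 2 e\<close>, so for \<open>deg p + deg q \<le> k + e + 2\<close>
  this part is \<open>(k - e)\<close>-independent, against its essential dependence. It is nonempty unless
  \<open>p\<close> divides \<open>q\<close>, because \<open>G\<close> has smaller degree than \<open>p\<close> otherwise. The bound on the degrees leaves
  out only \<open>e = 0\<close> with equality.\<close>

lemma least_degree_poly_factor:
  assumes Y: "finite Y" "essentially_dependent (int k) Y" and p: "least_degree_poly p Y"
    and q: "q \<noteq> 0" "\<And>A. A \<in> Y \<Longrightarrow> eval2 q A = 0"
    and deg: "total_degree p + total_degree q \<le> k + 3"
  shows "p dvd q \<or> (coprime p q \<and> total_degree p + total_degree q = k + 3)"
proof -
  define G e where "G = gcd p q" and "e = total_degree G"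
  have "p \<noteq> 0" by (rule least_degree_polyD(1)[OF p])
  then obtain p' q' where pq: "p = G * p'" "q = G * q'" "coprime p' q'"
    unfolding G_def by (metis gcd_coprime_exists gcd_eq_0_iff mult.commute)
  with \<open>p \<noteq> 0\<close> \<open>q \<noteq> 0\<close> have nz: "G \<noteq> 0" "p' \<noteq> 0" "q' \<noteq> 0" by auto
  have deg_p: "total_degree p = e + total_degree p'" and deg_q: "total_degree q = e + total_degree q'"
    unfolding pq(1,2) e_def using nz by (simp_all add: total_degree_mult)
  consider "total_degree p' = 0" | "total_degree p' > 0" "e = 0" "total_degree p + total_degree q = k + 3"
    | "total_degree p' > 0" "total_degree p + total_degree q \<le> k + e + 2"
    using deg by linarith
  then show ?thesis
  proof cases
    case 1
    then have "p' dvd 1" using nz by (simp add: is_unit_iff_total_degree)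
    then have "p dvd G * 1" unfolding pq(1) by (intro mult_dvd_mono) auto
    then show ?thesis by (auto simp: G_def)
  next
    case 2
    then have "G dvd 1" using nz by (simp add: is_unit_iff_total_degree e_def)
    then have "coprime p q" by (simp add: G_def coprime_iff_gcd_eq_1)
    then show ?thesis using 2 by simp
  next
    case 3
    let ?Y = "{A \<in> Y. eval2 G A \<noteq> 0}"
    have "\<exists>A\<in>Y. eval2 G A \<noteq> 0"
    proof (rule ccontr)
      assume "\<not> ?thesis"
      then have "total_degree p \<le> total_degree G"
        using nz by (intro least_degree_polyD(3)[OF p]) auto
      with 3(1) deg_p show False by (simp add: e_def)
    qed
    then obtain A where A: "A \<in> ?Y" by blast
    have "total_degree p \<le> total_degree q" using q by (rule least_degree_polyD(3)[OF p])
    then have ek: "e \<le> k" using deg deg_p 3(1) by linarith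
    have "independent_pts (int (k - e)) ?Y"
    proof (rule complete_intersection_independent[OF pq(3) nz(2,3)])
      show "eval2 p' A = 0 \<and> eval2 q' A = 0" if "A \<in> ?Y" for A
        using that q(2)[of A] least_degree_polyD(2)[OF p, of A] by (auto simp: pq(1,2))
      show "total_degree p' + total_degree q' \<le> k - e + 2"
        using 3(2) deg_p deg_q ek by linarith
    qed (use Y(1) in simp)
    moreover have "essentially_dependent (int (k - e)) ?Y"
      using essentially_dependent_off_curve[OF Y(2), of G] ek by (simp add: e_def of_nat_diff)
    ultimately show ?thesis using A
      unfolding independent_pts_def essentially_dependent_def by blast
  qed
qed

text \<open>No nonzero polynomial of degree less than \<open>n\<close> vanishes on \<open>Y\<close>, so \<open>Y\<close> imposes the full number
  \<open>dim_Pi n\<close> of conditions on these polynomials and contains an independent \<open>B\<close> of this size.\<close>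

lemma redundant_points:
  assumes Y: "finite Y" "essentially_dependent k Y" and p: "least_degree_poly p Y" "n \<le> total_degree p"
  obtains B where "B \<subseteq> Y" "dim_Pi n \<le> card B"
    "\<forall>q\<in>Pi_deg (k + 1 - int n). (\<forall>A\<in>Y - B. eval2 q A = 0) \<longrightarrow> (\<forall>A\<in>Y. eval2 q A = 0)"
proof -
  have "independent_pts (int n - 1) {}" by (simp add: independent_pts_def)
  from independent_subset_extends[OF empty_subsetI finite.emptyI this, of Y]
  obtain B where B: "{} \<subseteq> B" "B \<subseteq> Y" "finite B" "independent_pts (int n - 1) B" "card B \<le> dim_Pi n"
    "\<forall>q\<in>Pi_deg (int n - 1). (\<forall>C\<in>B. eval2 q C = 0) \<longrightarrow> (\<forall>A\<in>Y. eval2 q A = 0)" .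
  have "dim_Pi n \<le> card B"
  proof (rule ccontr)
    assume "\<not> dim_Pi n \<le> card B"
    then have "card B < dim_Pi n" by simp
    from vanishing_poly_exists[OF B(3) this] obtain q where
      q: "q \<in> Pi_deg (int n - 1)" "q \<noteq> 0" "\<forall>A\<in>B. eval2 q A = 0" .
    with B(6) have "\<forall>A\<in>Y. eval2 q A = 0" by blast
    then have "total_degree p \<le> total_degree q" using q(2) by (intro least_degree_polyD(3)[OF p(1)]) auto
    with q p(2) show False by (simp add: Pi_deg_def)
  qed
  moreover have "k + 1 - int n = k - (int n - 1)" by simp
  ultimately show ?thesis
    using that[of B] B(2) vanish_off_independent_imp_vanish[OF Y(2) B(2,4)] by metis
qed

text \<open>The multiples \<open>p w\<close> of degree less than \<open>n\<close> form a space of dimension \<open>dim_Pi (n - deg p)\<close>. As many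
  extra conditions, at suitable points off \<open>p = 0\<close>, exclude all of them.\<close>

lemma vanishing_nonmultiple_exists:
  assumes S: "finite S" "card S + dim_Pi (n - total_degree p) < dim_Pi n"
  obtains q where "q \<in> Pi_deg (int n - 1)" "\<forall>A\<in>S. eval2 q A = 0" "\<not> p dvd q"
proof -
  let ?m = "n - total_degree p"
  have "independent_pts (int ?m - 1) {}" by (simp add: independent_pts_def)
  from independent_subset_extends[OF empty_subsetI finite.emptyI this, of "{A. eval2 p A \<noteq> 0}"]
  obtain W where W: "{} \<subseteq> W" "W \<subseteq> {A. eval2 p A \<noteq> 0}" "finite W"
    "independent_pts (int ?m - 1) W" "card W \<le> dim_Pi ?m"
    "\<forall>f\<in>Pi_deg (int ?m - 1). (\<forall>C\<in>W. eval2 f C = 0) \<longrightarrow> (\<forall>A\<in>{A. eval2 p A \<noteq> 0}. eval2 f A = 0)" .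
  have "card (S \<union> W) < dim_Pi n" using card_Un_le[of S W] W(5) S(2) by linarith
  with S(1) W(3) obtain q where q: "q \<in> Pi_deg (int n - 1)" "q \<noteq> 0" "\<forall>A\<in>S \<union> W. eval2 q A = 0"
    by (metis vanishing_poly_exists finite_UnI)
  have "\<not> p dvd q"
  proof
    assume "p dvd q"
    then obtain w where w: "q = p * w" by (elim dvdE)
    with q(2) have "p \<noteq> 0" by auto
    with q(1) w have "w \<in> Pi_deg (int n - 1 - int (total_degree p))" by (metis Pi_deg_mult_cancel)
    then have "w \<in> Pi_deg (int ?m - 1)" by (rule Pi_deg_mono) linarith
    moreover have "\<forall>A\<in>W. eval2 w A = 0" using q(3) W(2) by (auto simp: w)
    ultimately have w0: "eval2 w A = 0" if "eval2 p A \<noteq> 0" for A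
      using W(6) that by blast
    have "eval2 q A = 0" for A
      using w0[of A] by (cases "eval2 p A = 0") (simp_all add: w)
    then have "q = 0" by (rule eq_0_if_vanishes_everywhere)
    with q(2) show False by simp
  qed
  with q show ?thesis by (intro that[of q]) auto
qed

text \<open>For \<open>r = d\<close> and \<open>s > d\<close> both sides agree: \<open>rs\<close> is the number of points of a complete intersection
  of degrees \<open>r\<close> and \<open>s\<close>, split into the conditions that these points impose in the degrees \<open>r - 1\<close>
  and \<open>s - 2\<close>. For \<open>s \<le> d + 1\<close> the difference of the two sides is \<open>(s - r)(s - r - 1) / 2\<close>.\<close>

lemma dim_Pi_inequality:
  assumes "r \<le> d" "r = d \<or> s \<le> d + 1" "1 \<le> s"
  shows "r * s + dim_Pi (s - 1 - d) \<le> dim_Pi (s - 1) + dim_Pi r"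
proof (cases "s \<le> d + 1")
  case True
  obtain j where j: "s = Suc j" using assms(3) by (cases s) auto
  have "0 \<le> (int j - int r) * (int j - int r + 1)"
    by (cases "int r \<le> int j") (auto intro: mult_nonneg_nonneg mult_nonpos_nonpos)
  then have "int (2 * (r * s)) \<le> int (j * (j + 1) + r * (r + 1))"
    by (simp add: j algebra_simps)
  then have "2 * (r * s) \<le> 2 * dim_Pi (s - 1) + 2 * dim_Pi r"
    unfolding two_dim_Pi j by (simp only: of_nat_le_iff diff_Suc_1)
  moreover have "dim_Pi (s - 1 - d) = 0" using True by (simp add: dim_Pi_def)
  ultimately show ?thesis by linarith
next
  case False
  with assms(2) obtain j where j: "r = d" "s = d + 1 + j" by (metis le_add_diff_inverse nat_le_linear)
  have "2 * (r * s) + 2 * dim_Pi j = 2 * dim_Pi (d + j) + 2 * dim_Pi r"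
    unfolding two_dim_Pi j by (simp add: algebra_simps)
  then show ?thesis using j by simp
qed

text \<open>A set with fewer than \<open>rs\<close> points would admit a polynomial of degree at most \<open>s - 2\<close> that vanishes
  on it and is not a multiple of \<open>p\<close>. The case \<open>r = deg p\<close> gives the size of the witness; the case
  of smaller \<open>r\<close>, where \<open>s - 2 < deg p\<close> leaves no such polynomial at all, covers sets that lie on
  curves of large degree only.\<close>

lemma card_essentially_dependent_ge:
  assumes Y: "finite Y" "essentially_dependent (int k) Y" and p: "least_degree_poly p Y"
    and rs: "r \<le> total_degree p" "r + s = k + 3" "r = total_degree p \<or> s \<le> total_degree p + 1"
  shows "r * s \<le> card Y"
proof (rule ccontr)
  assume "\<not> r * s \<le> card Y"
  then have less: "card Y < r * s" by simp
  then have s: "1 \<le> s" by (cases s) auto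
  from redundant_points[OF Y p rs(1)] obtain B where B: "B \<subseteq> Y" "dim_Pi r \<le> card B"
    "\<forall>q\<in>Pi_deg (int k + 1 - int r). (\<forall>A\<in>Y - B. eval2 q A = 0) \<longrightarrow> (\<forall>A\<in>Y. eval2 q A = 0)" .
  have "card (Y - B) + card B = card Y"
    using Y(1) B(1) by (metis card_Diff_subset card_mono finite_subset le_add_diff_inverse2)
  then have "card (Y - B) + dim_Pi (s - 1 - total_degree p) < dim_Pi (s - 1)"
    using dim_Pi_inequality[OF rs(1) rs(3) s] B(2) less by linarith
  with Y(1) obtain q where q: "q \<in> Pi_deg (int (s - 1) - 1)" "\<forall>A\<in>Y - B. eval2 q A = 0" "\<not> p dvd q"
    by (metis vanishing_nonmultiple_exists finite_Diff)
  have "int (s - 1) - 1 = int k + 1 - int r" using rs(2) s by linarith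
  with B(3) q(1,2) have van: "\<forall>A\<in>Y. eval2 q A = 0" by metis
  have q0: "q \<noteq> 0" using q(3) by auto
  have dq: "total_degree q + 2 \<le> s" using q(1) q0 s by (simp add: Pi_deg_def)
  have "total_degree p \<le> total_degree q"
    using q0 van by (intro least_degree_polyD(3)[OF p]) auto
  with dq rs(3) have "r = total_degree p" by linarith
  with dq rs(2) have "total_degree p + total_degree q < k + 3" by linarith
  with least_degree_poly_factor[OF Y p q0] van q(3) show False by auto
qed

section \<open>The criterion for dependence\<close>

text \<open>For degrees \<open>r\<close> from \<open>m\<close> to \<open>n\<close> the bound \<open>r (m + n - r)\<close> is at least \<open>mn\<close>; beyond \<open>n\<close> the general
  bound is applied with the factors \<open>n\<close> and \<open>m\<close>.\<close>

lemma card_ge_if_no_low_degree_poly: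
  assumes Y: "finite Y" "essentially_dependent (int k) Y" and p: "least_degree_poly p Y"
    and mn: "m \<le> n" "m + n = k + 3" "m \<le> total_degree p"
  shows "m * n \<le> card Y"
proof (cases "total_degree p \<le> n")
  case True
  let ?r = "total_degree p"
  obtain i j where ij: "?r = m + i" "n = ?r + j" using True mn(3) by (metis le_Suc_ex)
  have "m * n \<le> ?r * (m + n - ?r)" unfolding ij(2) by (simp add: ij(1) algebra_simps)
  also have "\<dots> \<le> card Y"
    using mn True by (intro card_essentially_dependent_ge[OF Y p]) auto
  finally show ?thesis .
next
  case False
  then have "n * m \<le> card Y"
    using mn by (intro card_essentially_dependent_ge[OF Y p]) auto
  then show ?thesis by (simp add: mult.commute)
qed

text \<open>The difference is exactly \<open>1\<close>: on a complete intersection of degrees \<open>r < s\<close> the vanishing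
  polynomials of degree at most \<open>s\<close> are the multiples of the first equation and one more.\<close>

lemma dim_Pi_strict_inequality:
  assumes "1 \<le> r" "r \<le> s"
  shows "r * s + dim_Pi (s + 1 - r) < dim_Pi (s + 1) + dim_Pi (r - 2)"
proof (cases "r = 1")
  case True
  have "2 * dim_Pi (s + 1) = 2 * (s + 1) + 2 * dim_Pi s"
    unfolding two_dim_Pi by (simp add: algebra_simps)
  then show ?thesis using True by simp
next
  case False
  with assms obtain i j where ij: "r = i + 2" "s = i + 2 + j"
    by (metis One_nat_def Suc_1 Suc_leI add.commute le_neq_implies_less le_Suc_ex)
  have "2 * dim_Pi (s + 1) + 2 * dim_Pi i = 2 * (r * s) + 2 * dim_Pi (j + 1) + 2"
    unfolding two_dim_Pi ij by (simp add: algebra_simps)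
  then show ?thesis using ij by simp
qed

text \<open>The second equation \<open>g\<close> has degree \<open>s\<close> and is coprime to \<open>p\<close> because it is not a multiple of \<open>p\<close>.
  Bezout's inequality then leaves no room: any \<open>h\<close> coprime to \<open>p\<close> that vanishes on \<open>Y\<close> has degree at
  least \<open>s\<close>. This applies to \<open>g\<close> with a repeated factor cancelled once.\<close>

lemma complete_intersection_if_card_eq:
  assumes Y: "finite Y" "essentially_dependent (int k) Y" and p: "least_degree_poly p Y"
    and r: "total_degree p = r" "1 \<le> r" "r \<le> s" "r + s = k + 3" and card: "card Y = r * s"
  obtains g where "squarefree g" "total_degree g = s" "Y = {A. eval2 p A = 0} \<inter> {A. eval2 g A = 0}"
proof -
  obtain B where B: "B \<subseteq> Y" "dim_Pi (r - 2) \<le> card B"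
    "\<forall>q\<in>Pi_deg (int s). (\<forall>A\<in>Y - B. eval2 q A = 0) \<longrightarrow> (\<forall>A\<in>Y. eval2 q A = 0)"
  proof (cases "r = 1")
    \<comment> \<open>Here \<open>r - 2\<close> is truncated; the empty set still has the required size \<open>0\<close>.\<close>
    case True
    then show ?thesis by (intro that[of "{}"]) (auto simp: dim_Pi_def)
  next
    case False
    have "r - 2 \<le> total_degree p" using r(1) by simp
    from redundant_points[OF Y p this] obtain B where B: "B \<subseteq> Y" "dim_Pi (r - 2) \<le> card B"
      "\<forall>q\<in>Pi_deg (int k + 1 - int (r - 2)). (\<forall>A\<in>Y - B. eval2 q A = 0) \<longrightarrow> (\<forall>A\<in>Y. eval2 q A = 0)" .
    have eq: "int k + 1 - int (r - 2) = int s" using False r by linarith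
    show ?thesis by (rule that[OF B(1,2) B(3)[unfolded eq]])
  qed
  have "card (Y - B) + card B = card Y"
    using Y(1) B(1) by (metis card_Diff_subset card_mono finite_subset le_add_diff_inverse2)
  then have "card (Y - B) + dim_Pi (s + 1 - total_degree p) < dim_Pi (s + 1)"
    using dim_Pi_strict_inequality[OF r(2,3)] B(2) card unfolding r(1) by linarith
  from vanishing_nonmultiple_exists[OF finite_Diff[OF Y(1)] this] obtain g where
    g: "g \<in> Pi_deg (int (s + 1) - 1)" "\<forall>A\<in>Y - B. eval2 g A = 0" "\<not> p dvd g" .
  have g_s: "g \<in> Pi_deg (int s)" using g(1) by simp
  with B(3) g(2) have van: "eval2 g A = 0" if "A \<in> Y" for A using that by blast
  have g0: "g \<noteq> 0" using g(3) by auto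
  have p0: "p \<noteq> 0" by (rule least_degree_polyD(1)[OF p])
  have "total_degree g \<le> s" using g_s g0 by (simp add: Pi_deg_def)
  then have "total_degree p + total_degree g \<le> k + 3" using r by linarith
  from least_degree_poly_factor[OF Y p g0 van this] g(3)
  have cop: "coprime p g" and "total_degree p + total_degree g = k + 3" by auto
  then have dg: "total_degree g = s" using r by linarith
  have count: "Y = {A. eval2 p A = 0} \<inter> {A. eval2 h A = 0} \<and> r * s \<le> r * total_degree h"
    if h: "h \<noteq> 0" "coprime p h" "\<And>A. A \<in> Y \<Longrightarrow> eval2 h A = 0" "total_degree h \<le> s" for h
  proof -
    let ?Z = "{A. eval2 p A = 0 \<and> eval2 h A = 0}"
    have Z: "finite ?Z" "card ?Z \<le> r * total_degree h"
      using bezout[OF h(2) p0 h(1)] r(1) by simp_all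
    have sub: "Y \<subseteq> ?Z" using h(3) least_degree_polyD(2)[OF p] by blast
    have "card ?Z \<le> card Y" 
      using Z(2) mult_le_mono2[OF h(4), of r] unfolding card by linarith
    with Z(1) sub have "Y = ?Z" by (rule card_seteq)
    moreover from this Z(2) card have "r * s \<le> r * total_degree h" by metis
    ultimately show ?thesis by (auto simp only: Int_def mem_Collect_eq)
  qed
  have "squarefree g"
  proof (rule squarefreeI)
    fix f assume "f ^ 2 dvd g"
    then obtain h where "g = f ^ 2 * h" by (elim dvdE)
    then have h: "g = f * (f * h)" by (simp add: power2_eq_square mult.assoc)
    with g0 have nz: "f \<noteq> 0" "f * h \<noteq> 0" by auto
    have dfh: "total_degree g = total_degree f + total_degree (f * h)"
      unfolding h using nz by (rule total_degree_mult)
    have "coprime p (f * h)" using cop unfolding h by simp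
    moreover have "eval2 (f * h) A = 0" if "A \<in> Y" for A using van[OF that] by (auto simp: h)
    ultimately have "r * s \<le> r * total_degree (f * h)"
      using count[of "f * h"] nz dg dfh by simp
    then have "s \<le> total_degree (f * h)" using r(2) by simp
    with dfh dg have "total_degree f = 0" by linarith
    then show "f dvd 1" using nz by (simp add: is_unit_iff_total_degree)
  qed
  with count[OF g0 cop van] dg show ?thesis by (intro that[of g]) auto
qed

text \<open>The fundamental polynomials of the remaining points of \<open>X\<close> can be used to correct a polynomial at
  these points, so that a fundamental polynomial with respect to the core would extend to \<open>X\<close>.\<close>

lemma essentially_dependent_core:
  assumes "finite X"
  shows "essentially_dependent k {A \<in> X. \<nexists>p. fundamental_poly k X A p}"
  unfolding essentially_dependent_def
proof (intro ballI notI)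
  let ?Y = "{A \<in> X. \<nexists>p. fundamental_poly k X A p}"
  fix A assume A: "A \<in> ?Y" and "\<exists>p. fundamental_poly k ?Y A p"
  then obtain f where f: "f \<in> Pi_deg k" "eval2 f A = 1" "\<forall>B\<in>?Y - {A}. eval2 f B = 0"
    by (auto simp: fundamental_poly_def)
  have "\<forall>B\<in>X - ?Y. \<exists>h. fundamental_poly k X B h" by blast
  then obtain h where h: "\<forall>B\<in>X - ?Y. fundamental_poly k X B (h B)" by metis
  define F where "F = f - (\<Sum>B\<in>X - ?Y. smult [:eval2 f B:] (h B))"
  have F: "eval2 F C = eval2 f C - (\<Sum>B\<in>X - ?Y. eval2 f B * (if B = C then 1 else 0))" if "C \<in> X" for C
    unfolding F_def eval2_simps eval2_sum
    using h that by (intro arg_cong2[of _ _ _ _ "(-)"] refl sum.cong) (auto simp: fundamental_poly_def)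
  have F_eq: "eval2 F C = (if C \<in> ?Y then eval2 f C else 0)" if "C \<in> X" for C
    using that assms unfolding F[OF that] by (auto simp: if_distrib[of "(*) _"] sum.delta cong: if_cong)
  have "F \<in> Pi_deg k"
    unfolding F_def using f(1) h by (intro Pi_deg_diff Pi_deg_sum Pi_deg_smult) (auto simp: fundamental_poly_def)
  moreover have "\<forall>B\<in>X - {A}. eval2 F B = 0" using f(3) F_eq by simp
  moreover have "eval2 F A \<noteq> 0" using A f(2) F_eq by simp
  ultimately have "\<exists>p. fundamental_poly k X A p" by (rule fundamental_polyI)
  with A show False by blast
qed

lemma essentially_dependent_subset_imp_dependent:
  assumes "essentially_dependent k Y" "Y \<subseteq> X" "Y \<noteq> {}"
  shows "dependent_pts k X"
  using assms unfolding essentially_dependent_def independent_pts_def fundamental_poly_def by blast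

lemma plane_curve_zero_set:
  "squarefree p \<Longrightarrow> plane_curve (total_degree p) {A. eval2 p A = 0}"
  unfolding plane_curve_def by blast

text \<open>Passing from curves, which have squarefree equations, to arbitrary polynomials loses nothing since
  polynomials of least degree are squarefree.\<close>

lemma least_degree_poly_iff_curve:
  assumes "finite Y" "squarefree p" "\<And>A. A \<in> Y \<Longrightarrow> eval2 p A = 0"
  shows "least_degree_poly p Y \<longleftrightarrow> \<not> (\<exists>d C. d < total_degree p \<and> plane_curve d C \<and> Y \<subseteq> C)"
proof
  assume p: "least_degree_poly p Y"
  show "\<not> (\<exists>d C. d < total_degree p \<and> plane_curve d C \<and> Y \<subseteq> C)"
  proof
    assume "\<exists>d C. d < total_degree p \<and> plane_curve d C \<and> Y \<subseteq> C"
    then obtain q where q: "squarefree q" "total_degree q < total_degree p" "Y \<subseteq> {A. eval2 q A = 0}"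
      unfolding plane_curve_def by blast
    then have "q \<noteq> 0" by auto
    then have "total_degree p \<le> total_degree q" using q(3) by (intro least_degree_polyD(3)[OF p]) auto
    with q(2) show False by simp
  qed
next
  assume no: "\<not> (\<exists>d C. d < total_degree p \<and> plane_curve d C \<and> Y \<subseteq> C)"
  obtain p0 where p0: "least_degree_poly p0 Y" using least_degree_poly_exists[OF assms(1)] .
  have "Y \<subseteq> {A. eval2 p0 A = 0}" using least_degree_polyD(2)[OF p0] by blast
  with no plane_curve_zero_set[OF least_degree_poly_squarefree[OF p0]]
  have "total_degree p \<le> total_degree p0" by (meson not_le)
  moreover have "p \<noteq> 0" using assms(2) by auto
  ultimately show "least_degree_poly p Y"
    using p0 assms(3) unfolding least_degree_poly_def by (meson le_trans)
qed

theorem theorem3p2: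
  fixes m n :: nat and \<kappa> :: int and X :: "(complex \<times> complex) set"
  assumes "1 \<le> m" and "m \<le> n"
    and "\<kappa> = int m + int n - 3"
    and "finite X" and "card X \<le> m * n - 1"
  shows "(dependent_pts \<kappa> X \<longleftrightarrow> (\<exists>r s Y. dependence_witness \<kappa> m X r s Y)) \<and>
    (\<forall>r s Y. dependence_witness \<kappa> m X r s Y \<longrightarrow> card Y = r * s \<longrightarrow>
      (\<exists>C D. plane_curve r C \<and> plane_curve s D \<and> Y = C \<inter> D))"
proof (intro conjI iffI allI impI)
  assume dep: "dependent_pts \<kappa> X"
  define Y where "Y = {A \<in> X. \<nexists>p. fundamental_poly \<kappa> X A p}"
  have Y: "finite Y" "Y \<subseteq> X" "essentially_dependent \<kappa> Y" "Y \<noteq> {}"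
    using assms(4) essentially_dependent_core[OF assms(4), of \<kappa>] dep
    unfolding Y_def independent_pts_def by auto
  have cardYX: "card Y \<le> card X" using Y(2) assms(4) by (intro card_mono)
  have "0 < card Y" using Y by (simp add: card_gt_0_iff)
  with cardYX have "2 \<le> m * n" using assms(5) by linarith
  then have "3 \<le> m + n" using assms(1,2) by (cases "m = 1") auto
  define k where "k = m + n - 3"
  have k: "\<kappa> = int k" "m + n = k + 3" using \<open>3 \<le> m + n\<close> assms(3) by (auto simp: k_def)
  have ess: "essentially_dependent (int k) Y" using Y(3) k by simp
  obtain p where p: "least_degree_poly p Y" using least_degree_poly_exists[OF Y(1)] .
  define r s where "r = total_degree p" and "s = m + n - r"
  have "\<not> m \<le> r"
    using card_ge_if_no_low_degree_poly[OF Y(1) ess p assms(2) k(2)] cardYX assms(5) \<open>2 \<le> m * n\<close>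
    by (auto simp: r_def)
  then have rm: "r \<le> m - 1" by simp
  have "r \<noteq> 0"
  proof
    assume "r = 0"
    then have "p dvd 1" using least_degree_polyD(1)[OF p] by (simp add: is_unit_iff_total_degree r_def)
    then obtain q where q: "1 = p * q" by (elim dvdE)
    obtain A where "A \<in> Y" using Y(4) by blast
    then have "eval2 p A = 0" by (rule least_degree_polyD(2)[OF p])
    then have "eval2 1 A = 0" unfolding q by simp
    then show False by simp
  qed
  have rs: "r + s = k + 3" using rm k by (simp add: s_def)
  have "r * s \<le> card Y"
    using rs by (intro card_essentially_dependent_ge[OF Y(1) ess p]) (auto simp: r_def)
  moreover have sq: "squarefree p" by (rule least_degree_poly_squarefree[OF p])
  moreover have "\<not> (\<exists>d C. d < r \<and> plane_curve d C \<and> Y \<subseteq> C)"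
    unfolding r_def using p least_degree_polyD(2)[OF p]
    by (subst least_degree_poly_iff_curve[OF Y(1) sq, symmetric]) auto
  moreover have "plane_curve r {A. eval2 p A = 0}" "Y \<subseteq> {A. eval2 p A = 0}"
    using plane_curve_zero_set[OF sq] least_degree_polyD(2)[OF p] by (auto simp: r_def)
  ultimately have "dependence_witness \<kappa> m X r s Y"
    unfolding dependence_witness_def using \<open>r \<noteq> 0\<close> rm rs k Y by auto
  then show "\<exists>r s Y. dependence_witness \<kappa> m X r s Y" by blast
next
  assume "\<exists>r s Y. dependence_witness \<kappa> m X r s Y"
  then obtain r s Y where w: "dependence_witness \<kappa> m X r s Y" by blast
  then have "0 < r * s" using assms(2,3) by (auto simp: dependence_witness_def)
  with w have "Y \<noteq> {}" by (auto simp: dependence_witness_def)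
  with w show "dependent_pts \<kappa> X"
    using essentially_dependent_subset_imp_dependent unfolding dependence_witness_def by blast
next
  fix r s Y assume w: "dependence_witness \<kappa> m X r s Y" and card: "card Y = r * s"
  have r: "1 \<le> r" "r \<le> m - 1" "int r + int s = int m + int n" 
    and Y: "Y \<subseteq> X" "essentially_dependent \<kappa> Y" "\<not> (\<exists>d C. d < r \<and> plane_curve d C \<and> Y \<subseteq> C)"
    using w assms(3) by (auto simp: dependence_witness_def)
  obtain p where p: "squarefree p" "total_degree p = r" "Y \<subseteq> {A. eval2 p A = 0}"
    using w unfolding dependence_witness_def plane_curve_def by blast
  have fin: "finite Y" using Y(1) assms(4) by (rule finite_subset)
  have least: "least_degree_poly p Y"
    using p Y(3) by (subst least_degree_poly_iff_curve[OF fin p(1)]) auto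
  define k where "k = m + n - 3"
  have k: "\<kappa> = int k" "r + s = k + 3" "r \<le> s" using r assms(2,3) by (auto simp: k_def)
  have ess: "essentially_dependent (int k) Y" using Y(2) k by simp
  obtain g where g: "squarefree g" "total_degree g = s"
    "Y = {A. eval2 p A = 0} \<inter> {A. eval2 g A = 0}"
    using complete_intersection_if_card_eq[OF fin ess least p(2) r(1) k(3,2) card] .
  show "\<exists>C D. plane_curve r C \<and> plane_curve s D \<and> Y = C \<inter> D"
    using plane_curve_zero_set[OF p(1)] plane_curve_zero_set[OF g(1)] p(2) g(2,3) by blast
qed

end
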